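(* Let $\mathcal{H}$, $\mathcal{V}$, $\mathcal{H}^\ast$, $\mathcal{G}$ be the classes of distribution functions defined in the context. Then: (i) $\mathcal{G}\subsetneq\mathcal{H}^\ast$, and $\mathcal{H}\subsetneq \mathcal{V}\subsetneq \mathcal{H}^\ast$ (all inclusions hold and all are proper). (ii) If $F\in\mathcal{H}$, then $F^\beta\in\mathcal{H}$ for all $\beta\ge 1$. If $F\in\mathcal{G}$, then $F^\beta\in\mathcal{G}$ for all $\beta>0$. If $F\in\mathcal{V}$ [resp. $F\in\mathcal{H}^\ast$], then $F^\beta\in\mathcal{V}$ [resp. $F^\beta\in\mathcal{H}^\ast$] for all $\beta\ge 1$. (iii) If $F\in\mathcal{V}$ [resp. $F\in\mathcal{H}$, $F\in\mathcal{H}^\ast$, $F\in\mathcal{G}$], then $1-\overline F^{\,\beta}\in\mathcal{V}$ [resp. $\mathcal{H}$, $\mathcal{H}^\ast$, $\mathcal{G}$] for all $\beta\in(0,1)$. (iv) If $F\in\mathcal{H}$ and $F\le_{\rm lr} G$, then $G\in\mathcal{H}$. If $F\in\mathcal{V}$ [resp. $F\in\mathcal{H}^\ast$] and $F\le_{\rm hr} G$, then $G\in\mathcal{V}$ [resp. $G\in\mathcal{H}^\ast$]. (Here $G$ is a distribution function.) (v) Let $w_1,\ldots,w_n\in\mathbb{R}_+$ with $\sum_{i=1}^n w_i=1$. - If $F_1,\ldots,F_n\in\mathcal{V}$, then $\sum_{i=1}^n w_iF_i\in\mathcal{V}$. - If $F_1,\ldots,F_n\in\mathcal{H}$ [resp.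 $\mathcal{H}^\ast$], then $\sum_{i=1}^n w_iF_i\in\mathcal{H}$ [resp. $\mathcal{H}^\ast$]. - If $F_1,\ldots,F_n\in\mathcal{G}$ and $F_1\le_{\rm st}\cdots\le_{\rm st}F_n$, then $\sum_{i=1}^n w_iF_i\in\mathcal{G}$.
   Context: All random variables are nonnegative. $\mathbb{R}_+=[0,\infty)$, $\mathbb{R}_{++}=(0,\infty)$. "Increasing" means nondecreasing. For a distribution function $F$, $\overline F=1-F$, and $F(0-)$ is the left limit of $F$ at $0$. A function $\varphi$ is subadditive if $\varphi(x+y)\le\varphi(x)+\varphi(y)$ for all $x,y$ in its domain. Let $F$ be a non-degenerate distribution function (i.e. not that of a constant) with $F(0-)=0$. - $F\in\mathcal{V}$ if $\theta\,\overline F(x)\le \overline F(x/\theta)$ for all $x\in\mathbb{R}_+$ and all $\theta\in(0,1)$ (equivalently, $x\overline F(x)$ is increasing in $x\in\mathbb{R}_+$). - $F\in\mathcal{H}$ if $x\mapsto\overline F(1/x)$ is concave on $\mathbb{R}_{++}$. - $F\in\mathcal{H}^\ast$ if $x\mapsto\overline F(1/x)$ is subadditive on $\mathbb{R}_{++}$. - $F\in\mathcal{G}$ if $\Lambda_F(x)=-\log F(1/x)$ is subadditive on $\mathbb{R}_{++}$ (with $\log 0=-\infty$), i.e. $F\left(\frac{1}{x+y}\right)\ge F\left(\frac1x\right)F\left(\frac1y\right)$ for all $x,y>0$. Stochastic orders (with the convention $a/0=+\infty$ for $a>0$, and $0/0$ not well-defined): - Usual stochastic order (first-order stochastic dominance):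 $F\le_{\rm st}G$ means $\overline F(x)\le\overline G(x)$ for all $x$. - Hazard rate order: $F\le_{\rm hr}G$ means that $\overline G(x)/\overline F(x)$ is increasing in $x$ over the points where the ratio is well-defined. - Likelihood ratio order: $F\le_{\rm lr}G$ means that $F$ and $G$ have density functions $f$ and $g$, respectively, such that $g(x)/f(x)$ is increasing in $x$ over the points where the ratio is well-defined. *)

theory Defs
  imports "HOL-Probability.Probability"
begin

definition distribution_function :: "(real \<Rightarrow> real) \<Rightarrow> bool" where
  "distribution_function F \<longleftrightarrow> (\<exists>M. real_distribution M \<and> F = cdf M)"

definition survival :: "(real \<Rightarrow> real) \<Rightarrow> real \<Rightarrow> real" where
  "survival F x = 1 - F x"

(* "return borel c" is the point mass at c. *)
definition degenerate :: "(real \<Rightarrow> real) \<Rightarrow> bool" where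
  "degenerate F \<longleftrightarrow> (\<exists>c. F = cdf (return borel c))"

(* Non-degenerate distribution functions F with F(0-) = 0; F may have an atom at 0. *)
definition nonneg_nondeg :: "(real \<Rightarrow> real) set" where
  "nonneg_nondeg =
     {F. distribution_function F \<and> \<not> degenerate F \<and> (F \<longlongrightarrow> 0) (at_left 0)}"

definition subadditive_on :: "real set \<Rightarrow> (real \<Rightarrow> 'b :: {ord, plus}) \<Rightarrow> bool" where
  "subadditive_on S \<phi> \<longleftrightarrow>
     (\<forall>x\<in>S. \<forall>y\<in>S. x + y \<in> S \<longrightarrow> \<phi> (x + y) \<le> \<phi> x + \<phi> y)"

(* The logarithm on [0,\<infinity>) with log 0 = -\<infinity>; the library's ln has ln 0 = 0. *)
definition log_ext :: "real \<Rightarrow> ereal" where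
  "log_ext p = (if p = 0 then -\<infinity> else ereal (ln p))"

definition Lambda :: "(real \<Rightarrow> real) \<Rightarrow> real \<Rightarrow> ereal" where
  "Lambda F x = - log_ext (F (1 / x))"

definition class_V :: "(real \<Rightarrow> real) set" where
  "class_V = {F \<in> nonneg_nondeg.
     \<forall>x\<ge>0. \<forall>\<theta>\<in>{0<..<1}. \<theta> * survival F x \<le> survival F (x / \<theta>)}"

definition class_H :: "(real \<Rightarrow> real) set" where
  "class_H = {F \<in> nonneg_nondeg. concave_on {0<..} (\<lambda>x. survival F (1 / x))}"

definition class_Hstar :: "(real \<Rightarrow> real) set" where
  "class_Hstar = {F \<in> nonneg_nondeg. subadditive_on {0<..} (\<lambda>x. survival F (1 / x))}"

definition class_G :: "(real \<Rightarrow> real) set" where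
  "class_G = {F \<in> nonneg_nondeg. subadditive_on {0<..} (Lambda F)}"

definition st_le :: "(real \<Rightarrow> real) \<Rightarrow> (real \<Rightarrow> real) \<Rightarrow> bool" where
  "st_le F G \<longleftrightarrow> (\<forall>x. survival F x \<le> survival G x)"

(* v/u is increasing over the points where it is well-defined, for nonnegative u and v.
   In ereal, a / 0 = \<infinity> for a > 0; only the points with 0 / 0 are left out. *)
definition ratio_increasing :: "(real \<Rightarrow> real) \<Rightarrow> (real \<Rightarrow> real) \<Rightarrow> bool" where
  "ratio_increasing u v \<longleftrightarrow>
     mono_on {x. \<not> (u x = 0 \<and> v x = 0)} (\<lambda>x. ereal (v x) / ereal (u x))"

definition hr_le :: "(real \<Rightarrow> real) \<Rightarrow> (real \<Rightarrow> real) \<Rightarrow> bool" where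
  "hr_le F G \<longleftrightarrow> ratio_increasing (survival F) (survival G)"

definition has_density :: "(real \<Rightarrow> real) \<Rightarrow> (real \<Rightarrow> real) \<Rightarrow> bool" where
  "has_density F f \<longleftrightarrow> f \<in> borel_measurable borel \<and> (\<forall>x. 0 \<le> f x) \<and>
     (\<forall>x. ennreal (F x) = (\<integral>\<^sup>+ t\<in>{..x}. ennreal (f t) \<partial>lborel))"

definition lr_le :: "(real \<Rightarrow> real) \<Rightarrow> (real \<Rightarrow> real) \<Rightarrow> bool" where
  "lr_le F G \<longleftrightarrow> (\<exists>f g. has_density F f \<and> has_density G g \<and> ratio_increasing f g)"

lemma distribution_function_bounds:
  assumes "distribution_function F"
  shows "0 \<le> F x" "F x \<le> 1"
  using assms real_distribution.cdf_bounded_prob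
  by (auto simp: distribution_function_def cdf_def)

lemma class_G_iff:
  "F \<in> class_G \<longleftrightarrow> F \<in> nonneg_nondeg \<and>
     (\<forall>x>0. \<forall>y>0. F (1 / (x + y)) \<ge> F (1 / x) * F (1 / y))"
proof -
  have *: "- log_ext c \<le> - log_ext a + - log_ext b \<longleftrightarrow> a * b \<le> c"
    if "0 \<le> a" "0 \<le> b" "0 \<le> c" for a b c :: real
  proof (cases "a = 0 \<or> b = 0 \<or> c = 0")
    case True
    then show ?thesis
      using that by (auto simp: log_ext_def mult_le_0_iff)
  next
    case False
    then have pos: "0 < a" "0 < b" "0 < c" using that by auto
    then have "- ln c \<le> - ln a + - ln b \<longleftrightarrow> ln (a * b) \<le> ln c"
      by (auto simp: ln_mult)
    also have "\<dots> \<longleftrightarrow> a * b \<le> c" using pos by simp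
    finally show ?thesis using pos by (simp add: log_ext_def)
  qed
  show ?thesis
  proof (cases "F \<in> nonneg_nondeg")
    case True
    then have "0 \<le> F x" for x
      by (simp add: nonneg_nondeg_def distribution_function_bounds)
    then show ?thesis
      using True by (simp add: class_G_def subadditive_on_def Lambda_def * Ball_def)
  qed (simp add: class_G_def)
qed

end

theory Submission
  imports Defs
begin

text \<open>
  Everything is read off the \<^emph>\<open>reciprocal tail\<close> \<open>u \<mapsto> 1 - F (1 / u)\<close> on \<open>(0, \<infinity>)\<close>, an increasing
  function with values in \<open>[0, 1]\<close>. In these terms \<open>\<H>\<close> says that the tail is concave,
  \<open>\<V>\<close> that it is star-shaped (its graph seen from the origin has decreasing slope),
  \<open>\<H>\<^sup>*\<close> that it is subadditive, and \<open>\<G>\<close> that it satisfies \<open>t(u + v) \<le> t(u) + t(v) - t(u) t(v)\<close>.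
  The inclusions are then the usual implications concave \<open>\<Rightarrow>\<close> star-shaped \<open>\<Rightarrow>\<close> subadditive, and
  two piecewise linear tails show that they are strict.

  Both kinds of power compose the tail with a concave increasing bijection of \<open>[0, 1]\<close>, namely
  \<open>p \<mapsto> 1 - (1 - p) powr \<beta>\<close> for \<open>\<beta> \<ge> 1\<close> and \<open>p \<mapsto> p powr \<beta>\<close> for \<open>\<beta> < 1\<close>. This preserves concavity,
  star-shape and subadditivity (\<open>distort_class_H\<close>, \<open>distort_class_V\<close>, \<open>distort_class_Hstar\<close>).
  For \<open>\<G>\<close> the power of \<open>F\<close> is immediate; the power of the survival function rests on the fact
  that \<open>p, q\<close> and \<open>p q, p + q - p q\<close> have the same sum and the second pair encloses the first, so
  that a concave function has the smaller total on the second pair (\<open>concave_on_majorised_pair\<close>).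

  For the stochastic orders, the quotients are replaced by cross-multiplied inequalities, in which
  no convention about division by zero is left. The hazard rate order gives
  \<open>G\<^sup>c(a) F\<^sup>c(b) \<le> F\<^sup>c(a) G\<^sup>c(b)\<close> for \<open>a \<le> b\<close>, where the superscript denotes the survival function.
  Integrating \<open>g(s) f(t) \<le> f(s) g(t)\<close> over two adjacent intervals shows that the likelihood
  ratio order makes increments of \<open>G\<close> relative to those of \<open>F\<close> grow from left to right
  (\<open>lr_le_increments\<close>), so that the tail of \<open>G\<close> is a concave function of the tail of \<open>F\<close>.
  In both cases it matters that a member of \<open>\<H>\<^sup>*\<close> has unbounded support (\<open>survival_pos\<close>).

  Mixing distributions mixes tails, and the conditions for \<open>\<V>\<close>, \<open>\<H>\<close> and \<open>\<H>\<^sup>*\<close> are linear in the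
  tail. The condition for \<open>\<G>\<close> is quadratic; there stochastic monotonicity makes
  \<open>i \<mapsto> F\<^sub>i (1 / x)\<close> and \<open>i \<mapsto> F\<^sub>i (1 / y)\<close> ordered alike, and Chebyshev's sum inequality applies.
\<close>

section \<open>Distribution functions on the half-line\<close>

lemma distribution_functionI:
  assumes "mono F" "\<And>a. continuous (at_right a) F" "(F \<longlongrightarrow> 0) at_bot" "(F \<longlongrightarrow> 1) at_top"
  shows "distribution_function F"
  unfolding distribution_function_def
  using real_distribution_interval_measure[of F] cdf_interval_measure[of F] assms
  by (metis monoD)

lemma distribution_functionD:
  assumes "distribution_function F"
  shows "mono F" "continuous (at_right a) F" "(F \<longlongrightarrow> 0) at_bot" "(F \<longlongrightarrow> 1) at_top"
proof -
  obtain M where M: "real_distribution M" "F = cdf M"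
    using assms unfolding distribution_function_def by blast
  interpret real_distribution M by fact
  show "mono F" "continuous (at_right a) F" "(F \<longlongrightarrow> 0) at_bot" "(F \<longlongrightarrow> 1) at_top"
    using M cdf_nondecreasing cdf_is_right_cont cdf_lim_at_bot cdf_lim_at_top_prob
    by (auto simp: mono_def)
qed

lemma cdf_point_mass: "cdf (return borel c) x = (if c \<le> x then 1 else 0)" for c x :: real
  by (simp add: cdf_def measure_return indicator_def)

text \<open>A distribution function without intermediate values jumps from 0 to 1 at the infimum of the
  points where it is 1; right continuity decides the value at the jump.\<close>

lemma degenerate_iff_zero_one:
  assumes "distribution_function F"
  shows "degenerate F \<longleftrightarrow> (\<forall>x. F x = 0 \<or> F x = 1)"
proof
  assume "degenerate F"
  then show "\<forall>x. F x = 0 \<or> F x = 1"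
    by (auto simp: degenerate_def cdf_point_mass)
next
  assume zo: "\<forall>x. F x = 0 \<or> F x = 1"
  note F = distribution_functionD[OF assms]
  define A where "A = {x. F x = 1}"
  have "eventually (\<lambda>x. F x > 1/2) at_top" "eventually (\<lambda>x. F x < 1/2) at_bot"
    using order_tendstoD(1)[OF F(4), of "1/2"] order_tendstoD(2)[OF F(3), of "1/2"] by auto
  then obtain p q where pq: "F p > 1/2" "F q < 1/2"
    by (metis eventually_happens trivial_limit_at_top_linorder trivial_limit_at_bot_linorder)
  have pA: "p \<in> A" and q0: "F q = 0"
    using zo pq unfolding A_def by (smt (verit) mem_Collect_eq field_sum_of_halves)+
  have qA: "q \<le> x" if "x \<in> A" for x
    using that q0 F(1) unfolding A_def mono_def
    by (smt (verit) mem_Collect_eq)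
  have bdd: "bdd_below A" using qA by (auto simp: bdd_below_def)
  define c where "c = Inf A"
  have above: "F x = 1" if "c < x" for x
  proof -
    have "\<exists>y\<in>A. y < x" using pA that by (intro cInf_lessD) (auto simp: c_def)
    then obtain y where "y \<in> A" "y < x" by blast
    then have "1 \<le> F x" using monoD[OF F(1), of y x] unfolding A_def by simp
    then show ?thesis using zo[rule_format, of x] by auto
  qed
  have below: "F x = 0" if "x < c" for x
    using that zo[rule_format, of x] cInf_lower[OF _ bdd, of x] unfolding c_def A_def by auto
  have "(F \<longlongrightarrow> F c) (at_right c)" using F(2)[of c] by (simp add: continuous_within)
  moreover have "(F \<longlongrightarrow> 1) (at_right c)"
    by (rule tendsto_eventually) (auto simp: eventually_at_filter above)
  ultimately have "F c = 1"
    using tendsto_unique trivial_limit_at_right_real by blast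
  then have "F = cdf (return borel c)"
    using above below by (force simp: cdf_point_mass)
  then show "degenerate F" unfolding degenerate_def by blast
qed

text \<open>The form in which membership is checked below: by monotonicity, a vanishing left limit at 0 is
  the same as vanishing on the negative half-line.\<close>

lemma nonneg_nondeg_iff:
  "F \<in> nonneg_nondeg \<longleftrightarrow>
     distribution_function F \<and> (\<exists>x. 0 < F x \<and> F x < 1) \<and> (\<forall>x<0. F x = 0)"
proof (cases "distribution_function F")
  case True
  note F = distribution_functionD[OF True] distribution_function_bounds[OF True]
  have "(F \<longlongrightarrow> 0) (at_left 0) \<longleftrightarrow> (\<forall>x<0. F x = 0)"
  proof
    assume lim: "(F \<longlongrightarrow> 0) (at_left 0)"
    show "\<forall>x<0. F x = 0"
    proof (intro allI impI)
      fix x :: real assume "x < 0"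
      have "eventually (\<lambda>y. F x \<le> F y) (at_left 0)"
        using eventually_at_left[OF \<open>x < 0\<close>] F(1) \<open>x < 0\<close> by (auto simp: mono_def intro: less_imp_le)
      then have "F x \<le> 0" using lim tendsto_lowerbound trivial_limit_at_left_real by blast
      then show "F x = 0" using F(5)[of x] by simp
    qed
  next
    assume "\<forall>x<0. F x = 0"
    then show "(F \<longlongrightarrow> 0) (at_left 0)"
      by (intro tendsto_eventually) (auto simp: eventually_at_filter)
  qed
  moreover have "\<not> degenerate F \<longleftrightarrow> (\<exists>x. 0 < F x \<and> F x < 1)"
    unfolding degenerate_iff_zero_one[OF True] using F(5,6)
    by (metis less_eq_real_def less_irrefl)
  ultimately show ?thesis using True by (simp add: nonneg_nondeg_def)
qed (simp add: nonneg_nondeg_def)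

section \<open>The reciprocal tail and the inclusions\<close>

definition tail :: "(real \<Rightarrow> real) \<Rightarrow> real \<Rightarrow> real" where
  "tail F u = survival F (1 / u)"

lemma tail_bounds:
  assumes "F \<in> nonneg_nondeg"
  shows "0 \<le> tail F u" "tail F u \<le> 1"
  using assms distribution_function_bounds[of F "1 / u"]
  by (auto simp: nonneg_nondeg_iff tail_def survival_def)

lemma tail_mono:
  assumes "F \<in> nonneg_nondeg" "0 < u" "u \<le> v"
  shows "tail F u \<le> tail F v"
proof -
  have "1 / v \<le> 1 / u" using assms by (simp add: frac_le)
  moreover have "mono F" using assms distribution_functionD(1) by (simp add: nonneg_nondeg_iff)
  ultimately show ?thesis
    using monoD[of F "1 / v" "1 / u"] by (simp add: tail_def survival_def)
qed

lemma class_H_iff: "F \<in> class_H \<longleftrightarrow> F \<in> nonneg_nondeg \<and> concave_on {0<..} (tail F)"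
  by (simp add: class_H_def tail_def[abs_def])

lemma class_Hstar_iff:
  "F \<in> class_Hstar \<longleftrightarrow> F \<in> nonneg_nondeg \<and>
     (\<forall>u>0. \<forall>v>0. tail F (u + v) \<le> tail F u + tail F v)"
  by (auto simp: class_Hstar_def subadditive_on_def tail_def)

text \<open>Substitute \<open>x = 1 / u\<close>. At \<open>x = 0\<close>, which is no reciprocal, both sides of the defining
  inequality involve the same value of the survival function.\<close>

lemma class_V_iff:
  "F \<in> class_V \<longleftrightarrow> F \<in> nonneg_nondeg \<and>
     (\<forall>u>0. \<forall>\<theta>\<in>{0<..<1}. \<theta> * tail F u \<le> tail F (\<theta> * u))"
proof (cases "F \<in> nonneg_nondeg")
  case True
  then have F0: "0 \<le> survival F 0"
    using distribution_function_bounds[of F 0] by (simp add: nonneg_nondeg_iff survival_def)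
  show ?thesis
  proof safe
    fix u \<theta> :: real assume F: "F \<in> class_V" and "0 < u" "\<theta> \<in> {0<..<1}"
    then have "\<theta> * survival F (1 / u) \<le> survival F ((1 / u) / \<theta>)"
      unfolding class_V_def by (blast intro: less_imp_le zero_less_divide_1_iff[THEN iffD2])
    then show "\<theta> * tail F u \<le> tail F (\<theta> * u)" by (simp add: tail_def mult.commute)
  next
    assume V: "\<forall>u>0. \<forall>\<theta>\<in>{0<..<1}. \<theta> * tail F u \<le> tail F (\<theta> * u)"
    have "\<theta> * survival F x \<le> survival F (x / \<theta>)" if "0 \<le> x" "\<theta> \<in> {0<..<1}" for x \<theta>
    proof (cases "x = 0")
      case True
      then show ?thesis using F0 that by (simp add: mult_left_le_one_le)
    next
      case False
      then have "0 < 1 / x" using that by simp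
      then have "\<theta> * tail F (1 / x) \<le> tail F (\<theta> * (1 / x))" using V that by blast
      then show ?thesis by (simp add: tail_def)
    qed
    then show "F \<in> class_V" using True by (simp add: class_V_def)
  qed (use True in simp)
qed (simp add: class_V_def)

lemma class_G_subset_class_Hstar: "class_G \<subseteq> class_Hstar"
proof
  fix F assume G: "F \<in> class_G"
  then have F: "F \<in> nonneg_nondeg" by (simp add: class_G_iff)
  have "tail F (u + v) \<le> tail F u + tail F v" if "0 < u" "0 < v" for u v
  proof -
    have "F (1 / u) * F (1 / v) \<le> F (1 / (u + v))" using G that by (simp add: class_G_iff)
    then have "tail F (u + v) \<le> tail F u + tail F v - tail F u * tail F v"
      by (simp add: tail_def survival_def algebra_simps)
    then show ?thesis using tail_bounds(1)[OF F] by (smt (verit) mult_nonneg_nonneg)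
  qed
  then show "F \<in> class_Hstar" using F by (simp add: class_Hstar_iff)
qed

text \<open>A nonnegative concave function on \<open>(0, \<infinity>)\<close> is star-shaped. The origin itself is outside the
  domain, so concavity is used on the segment from \<open>\<epsilon> u\<close> to \<open>u\<close> and \<open>\<epsilon>\<close> tends to 0.\<close>

lemma class_H_subset_class_V: "class_H \<subseteq> class_V"
proof
  fix F assume H: "F \<in> class_H"
  then have F: "F \<in> nonneg_nondeg" and conc: "concave_on {0<..} (tail F)"
    by (auto simp: class_H_iff)
  have "\<theta> * tail F u \<le> tail F (\<theta> * u)" if u: "0 < u" and \<theta>: "\<theta> \<in> {0<..<1}" for u \<theta>
  proof -
    have ineq: "(\<theta> - \<epsilon>) / (1 - \<epsilon>) * tail F u \<le> tail F (\<theta> * u)" if \<epsilon>: "0 < \<epsilon>" "\<epsilon> < \<theta>" for \<epsilon>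
    proof -
      define l where "l = (\<theta> - \<epsilon>) / (1 - \<epsilon>)"
      have l: "0 \<le> l" "l \<le> 1" "\<theta> * u = (1 - l) * (\<epsilon> * u) + l * u"
        using \<epsilon> \<theta> by (auto simp: l_def divide_simps) (simp add: algebra_simps)
      have "(1 - l) * tail F (\<epsilon> * u) + l * tail F u \<le> tail F ((1 - l) * (\<epsilon> * u) + l * u)"
        using concave_onD[OF conc l(1,2), of "\<epsilon> * u" u] u \<epsilon> by simp
      then show ?thesis
        using l tail_bounds(1)[OF F, of "\<epsilon> * u"]
        unfolding l_def[symmetric] by (smt (verit) mult_nonneg_nonneg)
    qed
    have "((\<lambda>\<epsilon>. (\<theta> - \<epsilon>) / (1 - \<epsilon>) * tail F u) \<longlongrightarrow> (\<theta> - 0) / (1 - 0) * tail F u) (at_right 0)"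
      by (intro tendsto_intros) auto
    moreover have "eventually (\<lambda>\<epsilon>. (\<theta> - \<epsilon>) / (1 - \<epsilon>) * tail F u \<le> tail F (\<theta> * u)) (at_right 0)"
      using ineq \<theta> by (auto simp: eventually_at_right[of 0 1] intro!: exI[of _ \<theta>])
    ultimately have "(\<theta> - 0) / (1 - 0) * tail F u \<le> tail F (\<theta> * u)"
      using tendsto_upperbound trivial_limit_at_right_real by blast
    then show ?thesis by simp
  qed
  then show "F \<in> class_V" using F by (simp add: class_V_iff)
qed

text \<open>Star-shape bounds the values at \<open>u\<close> and \<open>v\<close> below by the shares \<open>u / (u + v)\<close> and
  \<open>v / (u + v)\<close> of the value at \<open>u + v\<close>, and these shares add up to the whole.\<close>

lemma class_V_subset_class_Hstar: "class_V \<subseteq> class_Hstar"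
proof
  fix F assume V: "F \<in> class_V"
  have part: "u / (u + v) * tail F (u + v) \<le> tail F u" if "0 < u" "0 < v" for u v
  proof -
    have "u / (u + v) * tail F (u + v) \<le> tail F (u / (u + v) * (u + v))"
      using V that unfolding class_V_iff by (auto simp del: times_divide_eq_left)
    then show ?thesis using that by simp
  qed
  have "tail F (u + v) \<le> tail F u + tail F v" if "0 < u" "0 < v" for u v
  proof -
    have "tail F (u + v) = u / (u + v) * tail F (u + v) + v / (v + u) * tail F (v + u)"
      using that by (simp add: add.commute[of v u] flip: distrib_right add_divide_distrib)
    then show ?thesis using part[OF that] part[OF that(2,1)] by linarith
  qed
  then show "F \<in> class_Hstar" using V by (simp add: class_V_iff class_Hstar_iff)
qed

text \<open>If the tail vanished at \<open>u\<close>, subadditivity would make it vanish at \<open>2 ^ n * u\<close> for every \<open>n\<close>,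
  hence everywhere; all the mass would then sit at 0, contrary to non-degeneracy.\<close>

lemma tail_pos:
  assumes "F \<in> class_Hstar" "0 < u"
  shows "0 < tail F u"
proof (rule ccontr)
  have F: "F \<in> nonneg_nondeg" using assms by (simp add: class_Hstar_iff)
  then have dF: "distribution_function F" by (simp add: nonneg_nondeg_iff)
  assume "\<not> 0 < tail F u"
  then have u0: "tail F u = 0" using tail_bounds(1)[OF F, of u] by simp
  have zero: "tail F (2 ^ n * u) = 0" for n
  proof (induction n)
    case (Suc n)
    have "0 < 2 ^ n * u" using assms(2) by simp
    then have "tail F (2 ^ n * u + 2 ^ n * u) \<le> tail F (2 ^ n * u) + tail F (2 ^ n * u)"
      using assms(1) unfolding class_Hstar_iff by blast
    then have "tail F (2 ^ n * u + 2 ^ n * u) = 0"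
      using Suc tail_bounds(1)[OF F, of "2 ^ n * u + 2 ^ n * u"] by linarith
    moreover have "2 ^ Suc n * u = 2 ^ n * u + 2 ^ n * u" by simp
    ultimately show ?case by (simp only:)
  qed (simp add: u0)
  have one: "F x = 1" if "0 < x" for x
  proof -
    obtain n where "1 / (x * u) < 2 ^ n" using real_arch_pow[of 2 "1 / (x * u)"] by auto
    then have "1 / x \<le> 2 ^ n * u" using that assms(2) by (simp add: field_simps)
    then have "tail F (1 / x) = 0"
      using tail_mono[OF F, of "1 / x" "2 ^ n * u"] zero[of n] that tail_bounds(1)[OF F, of "1 / x"]
      by simp
    then show ?thesis by (simp add: tail_def survival_def)
  qed
  have "(F \<longlongrightarrow> F 0) (at_right 0)"
    using distribution_functionD(2)[OF dF, of 0] by (simp add: continuous_within)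
  moreover have "(F \<longlongrightarrow> 1) (at_right 0)"
    by (rule tendsto_eventually) (auto simp: eventually_at_filter one)
  ultimately have "F 0 = 1" using tendsto_unique trivial_limit_at_right_real by blast
  then have "F x = 0 \<or> F x = 1" for x
    using one[of x] F by (cases "x < 0"; cases "x = 0") (auto simp: nonneg_nondeg_iff)
  then show False using F unfolding nonneg_nondeg_iff by (metis less_irrefl)
qed

lemma survival_pos:
  assumes "F \<in> class_Hstar"
  shows "0 < survival F x"
proof (cases "0 < x")
  case True
  then show ?thesis using tail_pos[OF assms, of "1 / x"] by (simp add: tail_def)
next
  case False
  have "0 < tail F 1" using tail_pos[OF assms] by simp
  moreover have "mono F"
    using assms distribution_functionD(1) by (simp add: class_Hstar_iff nonneg_nondeg_iff)
  then have "F x \<le> F 1" using False by (simp add: monoD)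
  ultimately show ?thesis by (simp add: tail_def survival_def)
qed

section \<open>Concave distortions\<close>

definition distort :: "(real \<Rightarrow> real) \<Rightarrow> (real \<Rightarrow> real) \<Rightarrow> real \<Rightarrow> real" where
  "distort K F x = 1 - K (survival F x)"

text \<open>Strict monotonicity, and not mere monotonicity, is what keeps a distorted distribution
  non-degenerate; continuity keeps it right-continuous.\<close>

definition distortion :: "(real \<Rightarrow> real) \<Rightarrow> bool" where
  "distortion K \<longleftrightarrow>
     continuous_on {0..1} K \<and> strict_mono_on {0..1} K \<and> K 0 = 0 \<and> K 1 = 1"

lemma tail_distort: "tail (distort K F) u = K (tail F u)"
  by (simp add: tail_def distort_def survival_def)

lemma distort_nonneg_nondeg:
  assumes K: "distortion K" and F: "F \<in> nonneg_nondeg"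
  shows "distort K F \<in> nonneg_nondeg"
proof -
  have dF: "distribution_function F" using F by (simp add: nonneg_nondeg_iff)
  note D = distribution_functionD[OF dF]
  have S: "survival F x \<in> {0..1}" for x
    using distribution_function_bounds[OF dF, of x] by (simp add: survival_def)
  have K_lt: "K p < K q" if "p \<in> {0..1}" "q \<in> {0..1}" "p < q" for p q
    using K that by (auto simp: distortion_def strict_mono_on_def)
  have K_le: "K p \<le> K q" if "p \<in> {0..1}" "q \<in> {0..1}" "p \<le> q" for p q
    using K_lt[OF that(1,2)] that(3) by (cases "p = q") auto
  have K01: "K 0 = 0" "K 1 = 1" using K by (auto simp: distortion_def)
  have lim: "((\<lambda>x. K (survival F x)) \<longlongrightarrow> K (1 - l)) \<F>"
    if "(F \<longlongrightarrow> l) \<F>" "l \<in> {0..1}" for \<F> l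
  proof (rule continuous_on_tendsto_compose[of "{0..1}" K "survival F"])
    show "continuous_on {0..1} K" using K by (simp add: distortion_def)
    show "(survival F \<longlongrightarrow> 1 - l) \<F>"
      unfolding survival_def[abs_def] using that by (intro tendsto_intros)
  qed (use that S in auto)
  have "distribution_function (distort K F)"
  proof (rule distribution_functionI)
    show "mono (distort K F)"
    proof (rule monoI)
      fix x y :: real assume "x \<le> y"
      then have "survival F y \<le> survival F x" using monoD[OF D(1)] by (simp add: survival_def)
      then show "distort K F x \<le> distort K F y" using K_le S by (simp add: distort_def)
    qed
    show "continuous (at_right a) (distort K F)" for a
      using lim[of "F a" "at_right a"] D(2)[of a] S[of a]
      unfolding continuous_within distort_def[abs_def] survival_def by (intro tendsto_intros) auto
    show "(distort K F \<longlongrightarrow> 0) at_bot"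
      using tendsto_diff[OF tendsto_const[of 1] lim[OF D(3)]] K01 by (simp add: distort_def[abs_def])
    show "(distort K F \<longlongrightarrow> 1) at_top"
      using tendsto_diff[OF tendsto_const[of 1] lim[OF D(4)]] K01 by (simp add: distort_def[abs_def])
  qed
  moreover obtain x where x: "0 < F x" "F x < 1" using F by (auto simp: nonneg_nondeg_iff)
  have "0 < distort K F x \<and> distort K F x < 1"
    using K_lt[of 0 "survival F x"] K_lt[of "survival F x" 1] x K01
    by (simp add: distort_def survival_def)
  moreover have "\<forall>x<0. distort K F x = 0"
    using F K01 by (simp add: nonneg_nondeg_iff distort_def survival_def)
  ultimately show ?thesis by (auto simp: nonneg_nondeg_iff)
qed

lemma concave_distortion_scale:
  assumes "distortion K" "concave_on {0..1} K" "p \<in> {0..1}" "\<theta> \<in> {0..1}"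
  shows "\<theta> * K p \<le> K (\<theta> * p)"
  using concave_onD[OF assms(2), of \<theta> 0 p] assms by (simp add: distortion_def)

lemma distortion_mono:
  assumes "distortion K" "0 \<le> p" "p \<le> q" "q \<le> 1"
  shows "K p \<le> K q"
  using assms by (cases "p = q") (auto simp: distortion_def strict_mono_on_def intro: less_imp_le)

text \<open>A concave function vanishing at 0 is subadditive by the argument used for the inclusion of \<open>\<V>\<close>
  in \<open>\<H>\<^sup>*\<close>. Since \<open>p + q\<close> may exceed 1, where \<open>K\<close> is not controlled, it is run with the truncation
  \<open>min 1 (p + q)\<close> in its place; the third argument \<open>r\<close> stands for the tail at a sum.\<close>

lemma concave_distortion_subadditive:
  assumes K: "distortion K" "concave_on {0..1} K"
    and pq: "p \<in> {0..1}" "q \<in> {0..1}" and r: "r \<in> {0..1}" "r \<le> p + q"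
  shows "K r \<le> K p + K q"
proof (cases "p + q = 0")
  case True
  then have "r = 0" "p = 0" "q = 0" using pq r by auto
  then show ?thesis using K by (simp add: distortion_def)
next
  case False
  then have s: "0 < p + q" using pq by auto
  define m where "m = min 1 (p + q)"
  have m: "m \<in> {0..1}" "m \<le> p + q" "r \<le> m" using s r by (auto simp: m_def)
  have share: "x / (p + q) * K m \<le> K x" if x: "x \<in> {p, q}" for x
  proof -
    have x01: "0 \<le> x" "x \<le> p + q" "x \<le> 1" using x pq by auto
    have "x / (p + q) * K m \<le> K (x / (p + q) * m)"
      using concave_distortion_scale[OF K m(1), of "x / (p + q)"] x01 s by simp
    also have "\<dots> \<le> K x"
    proof (rule distortion_mono[OF K(1)])
      show "x / (p + q) * m \<le> x"
        using m(2) x01 s by (simp add: divide_simps mult_left_mono)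
    qed (use x01 s m in auto)
    finally show ?thesis .
  qed
  have "K r \<le> K m" using distortion_mono[OF K(1)] r m by auto
  also have "\<dots> = p / (p + q) * K m + q / (p + q) * K m"
    using s by (simp flip: distrib_right add_divide_distrib)
  also have "\<dots> \<le> K p + K q" using share by (intro add_mono) auto
  finally show ?thesis .
qed

lemma distort_class_V:
  assumes K: "distortion K" "concave_on {0..1} K" and F: "F \<in> class_V"
  shows "distort K F \<in> class_V"
proof -
  have F0: "F \<in> nonneg_nondeg" using F by (simp add: class_V_iff)
  have "\<theta> * K (tail F u) \<le> K (tail F (\<theta> * u))" if "0 < u" "\<theta> \<in> {0<..<1}" for u \<theta>
  proof -
    have "\<theta> * K (tail F u) \<le> K (\<theta> * tail F u)"
      using concave_distortion_scale[OF K] tail_bounds[OF F0, of u] that by simp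
    also have "\<dots> \<le> K (tail F (\<theta> * u))"
      using F that tail_bounds[OF F0] by (intro distortion_mono[OF K(1)]) (auto simp: class_V_iff)
    finally show ?thesis .
  qed
  then show ?thesis
    using distort_nonneg_nondeg[OF K(1) F0] by (simp add: class_V_iff tail_distort)
qed

lemma distort_class_Hstar:
  assumes K: "distortion K" "concave_on {0..1} K" and F: "F \<in> class_Hstar"
  shows "distort K F \<in> class_Hstar"
proof -
  have F0: "F \<in> nonneg_nondeg" using F by (simp add: class_Hstar_iff)
  show ?thesis
    using distort_nonneg_nondeg[OF K(1) F0] F concave_distortion_subadditive[OF K] tail_bounds[OF F0]
    by (simp add: class_Hstar_iff tail_distort)
qed

lemma distort_class_H:
  assumes K: "distortion K" "concave_on {0..1} K" and F: "F \<in> class_H"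
  shows "distort K F \<in> class_H"
proof -
  have F0: "F \<in> nonneg_nondeg" and conc: "concave_on {0<..} (tail F)"
    using F by (auto simp: class_H_iff)
  have "concave_on {0<..} (tail (distort K F))"
    unfolding concave_on_iff
  proof safe
    fix x y u v :: real
    assume xy: "0 < x" "0 < y" and uv: "0 \<le> u" "0 \<le> v" "u + v = 1"
    let ?z = "u *\<^sub>R x + v *\<^sub>R y"
    have T: "tail F x \<in> {0..1}" "tail F y \<in> {0..1}" using tail_bounds[OF F0] by auto
    have c: "u * tail F x + v * tail F y \<in> {0..1}"
      using convexD[OF convex_real_interval(5) T uv] by simp
    have "u * K (tail F x) + v * K (tail F y) \<le> K (u * tail F x + v * tail F y)"
      using K(2) T uv unfolding concave_on_iff by (metis real_scaleR_def)
    also have "\<dots> \<le> K (tail F ?z)"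
      using conc xy uv tail_bounds[OF F0] c unfolding concave_on_iff
      by (intro distortion_mono[OF K(1)]) auto
    finally show "u * tail (distort K F) x + v * tail (distort K F) y \<le> tail (distort K F) ?z"
      by (simp add: tail_distort)
  qed
  then show ?thesis using distort_nonneg_nondeg[OF K(1) F0] by (simp add: class_H_iff)
qed

section \<open>Powers of distribution and survival functions\<close>

text \<open>The second derivative settles the open half-line. The endpoint 0, where the power function need
  not be differentiable, is treated directly: there the claim reduces to \<open>t \<le> t powr \<beta>\<close>.\<close>

lemma concave_powr_unit:
  fixes \<beta> :: real
  assumes "0 < \<beta>" "\<beta> \<le> 1"
  shows "concave_on {0..1} (\<lambda>p. p powr \<beta>)"
proof (rule concave_on_linorderI)
  have inner: "concave_on {0<..} (\<lambda>p. p powr \<beta>)"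
  proof (rule f''_le0_imp_concave)
    show "((\<lambda>p. p powr \<beta>) has_real_derivative \<beta> * x powr (\<beta> - 1)) (at x)" if "x \<in> {0<..}" for x
      using that by (auto intro!: derivative_eq_intros)
    show "((\<lambda>p. \<beta> * p powr (\<beta> - 1)) has_real_derivative \<beta> * ((\<beta> - 1) * x powr (\<beta> - 2))) (at x)"
      if "x \<in> {0<..}" for x
      using that by (auto intro!: derivative_eq_intros)
    show "\<beta> * ((\<beta> - 1) * x powr (\<beta> - 2)) \<le> 0" for x
      using assms by (simp add: mult_le_0_iff)
  qed simp
  fix t x y :: real
  assume t: "0 < t" "t < 1" and xy: "x \<in> {0..1}" "y \<in> {0..1}" "x < y"
  show "((1 - t) *\<^sub>R x + t *\<^sub>R y) powr \<beta> \<ge> (1 - t) * x powr \<beta> + t * y powr \<beta>"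
  proof (cases "x = 0")
    case True
    have "t powr 1 \<le> t powr \<beta>" using t assms by (intro powr_mono') auto
    then have "t * y powr \<beta> \<le> t powr \<beta> * y powr \<beta>" using t by (intro mult_right_mono) auto
    also have "\<dots> = (t * y) powr \<beta>" using t xy by (simp add: powr_mult)
    finally show ?thesis using True by simp
  next
    case False
    then show ?thesis using concave_onD[OF inner, of t x y] t xy by auto
  qed
qed simp

lemma convex_powr_unit:
  fixes \<beta> :: real
  assumes "1 \<le> \<beta>"
  shows "convex_on {0..1} (\<lambda>p. p powr \<beta>)"
proof (rule convex_on_linorderI)
  fix t x y :: real
  assume t: "0 < t" "t < 1" and xy: "x \<in> {0..1}" "y \<in> {0..1}" "x < y"
  show "((1 - t) *\<^sub>R x + t *\<^sub>R y) powr \<beta> \<le> (1 - t) * x powr \<beta> + t * y powr \<beta>"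
  proof (cases "x = 0")
    case True
    have "t powr \<beta> \<le> t powr 1" using t assms by (intro powr_mono') auto
    then have "t powr \<beta> * y powr \<beta> \<le> t * y powr \<beta>" using t by (intro mult_right_mono) auto
    then show ?thesis using True t xy by (simp add: powr_mult)
  next
    case False
    then show ?thesis using convex_onD[OF powr_convex[OF assms], of t x y] t xy by auto
  qed
qed simp

lemma distortion_powr:
  assumes "0 < \<beta>"
  shows "distortion (\<lambda>p. p powr \<beta>)"
  using assms unfolding distortion_def strict_mono_on_def
  by (auto intro!: continuous_intros continuous_on_powr' powr_less_mono2)

lemma distortion_dual_powr:
  assumes "0 < \<beta>"
  shows "distortion (\<lambda>p. 1 - (1 - p) powr \<beta>)"
  using assms unfolding distortion_def strict_mono_on_def
  by (auto intro!: continuous_intros continuous_on_powr' powr_less_mono2)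

lemma concave_dual_powr_unit:
  fixes \<beta> :: real
  assumes "1 \<le> \<beta>"
  shows "concave_on {0..1} (\<lambda>p. 1 - (1 - p) powr \<beta>)"
  unfolding concave_on_iff
proof safe
  fix x y u v :: real
  assume xy: "x \<in> {0..1}" "y \<in> {0..1}" and uv: "0 \<le> u" "0 \<le> v" "u + v = 1"
  have "(u *\<^sub>R (1 - x) + v *\<^sub>R (1 - y)) powr \<beta> \<le> u * (1 - x) powr \<beta> + v * (1 - y) powr \<beta>"
    using convex_powr_unit[OF assms] xy uv unfolding convex_on_def by auto
  moreover have "u *\<^sub>R (1 - x) + v *\<^sub>R (1 - y) = 1 - (u *\<^sub>R x + v *\<^sub>R y)"
    using uv by (simp add: algebra_simps flip: distrib_left)
  ultimately have "(1 - (u *\<^sub>R x + v *\<^sub>R y)) powr \<beta> \<le> u * (1 - x) powr \<beta> + v * (1 - y) powr \<beta>"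
    by simp
  then show "u * (1 - (1 - x) powr \<beta>) + v * (1 - (1 - y) powr \<beta>)
      \<le> 1 - (1 - (u *\<^sub>R x + v *\<^sub>R y)) powr \<beta>"
    using uv(3) by (simp add: algebra_simps)
qed

lemma powr_cdf_eq_distort:
  "(\<lambda>x. F x powr \<beta>) = distort (\<lambda>p. 1 - (1 - p) powr \<beta>) F"
  by (simp add: fun_eq_iff distort_def survival_def)

lemma powr_survival_eq_distort:
  "(\<lambda>x. 1 - survival F x powr \<beta>) = distort (\<lambda>p. p powr \<beta>) F"
  by (simp add: fun_eq_iff distort_def)

lemma powr_cdf_class_G:
  assumes "F \<in> class_G" "0 < \<beta>"
  shows "(\<lambda>x. F x powr \<beta>) \<in> class_G"
proof -
  have F: "F \<in> nonneg_nondeg" using assms by (simp add: class_G_iff)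
  have F0: "0 \<le> F x" for x using F distribution_function_bounds by (simp add: nonneg_nondeg_iff)
  have "F (1 / x) powr \<beta> * F (1 / y) powr \<beta> \<le> F (1 / (x + y)) powr \<beta>" if "0 < x" "0 < y" for x y
    using assms that F0 by (auto simp: class_G_iff simp flip: powr_mult intro!: powr_mono2)
  then show ?thesis
    using distort_nonneg_nondeg[OF distortion_dual_powr[OF assms(2)] F]
    by (simp add: class_G_iff flip: powr_cdf_eq_distort)
qed

text \<open>The pair \<open>(a, b)\<close> is majorised by the pair \<open>(l, m)\<close>: it lies inside with the same sum, so the
  convex combination that gives \<open>a\<close> gives \<open>b\<close> when its weights are exchanged.\<close>

lemma concave_on_majorised_pair:
  fixes K :: "real \<Rightarrow> real"
  assumes K: "concave_on S K" and lm: "l \<in> S" "m \<in> S"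
    and a: "l \<le> a" "a \<le> m" and sum: "a + b = l + m"
  shows "K l + K m \<le> K a + K b"
proof (cases "l = m")
  case False
  then have lt: "0 < m - l" using a by simp
  define t where "t = (a - l) / (m - l)"
  have t: "0 \<le> t" "t \<le> 1" using a lt by (auto simp: t_def)
  have tm: "t * (m - l) = a - l" using lt by (simp add: t_def)
  have at: "a = (1 - t) *\<^sub>R l + t *\<^sub>R m" and bt: "b = (1 - (1 - t)) *\<^sub>R l + (1 - t) *\<^sub>R m"
    using tm sum by (auto simp: algebra_simps)
  have "(1 - t) * K l + t * K m \<le> K a" unfolding at by (rule concave_onD[OF K t lm])
  moreover have "(1 - (1 - t)) * K l + (1 - t) * K m \<le> K b"
    unfolding bt by (rule concave_onD[OF K _ _ lm]) (use t in auto)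
  ultimately show ?thesis by (simp add: algebra_simps)
qed (use a sum in simp)

text \<open>With \<open>a, b, c\<close> the tails at \<open>x, y, x + y\<close>, the hypothesis reads \<open>c \<le> m\<close> for
  \<open>m = a + b - a b\<close>. Since \<open>a b\<close> and \<open>m\<close> enclose \<open>a\<close> and \<open>b\<close> and have the same sum, concavity gives
  \<open>m powr \<beta> \<le> a powr \<beta> + b powr \<beta> - (a b) powr \<beta>\<close>, and multiplicativity of the power turns this
  into the same inequality for the powers.\<close>

lemma powr_survival_class_G:
  assumes G: "F \<in> class_G" and \<beta>: "0 < \<beta>" "\<beta> < 1"
  shows "(\<lambda>x. 1 - survival F x powr \<beta>) \<in> class_G"
proof -
  have F: "F \<in> nonneg_nondeg" using G by (simp add: class_G_iff)
  have "(1 - tail F x powr \<beta>) * (1 - tail F y powr \<beta>) \<le> 1 - tail F (x + y) powr \<beta>"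
    if xy: "0 < x" "0 < y" for x y
  proof -
    let ?a = "tail F x" and ?b = "tail F y" and ?c = "tail F (x + y)"
    let ?m = "?a + ?b - ?a * ?b"
    have ab: "0 \<le> ?a" "?a \<le> 1" "0 \<le> ?b" "?b \<le> 1" "0 \<le> ?c" using tail_bounds[OF F] by auto
    have "(1 - ?a) * (1 - ?b) \<le> 1 - ?c" using G xy by (simp add: class_G_iff tail_def survival_def)
    then have c: "?c \<le> ?m" by (simp add: algebra_simps)
    have ord: "?a * ?b \<le> ?a" "?a * ?b \<le> ?b" "0 \<le> (1 - ?a) * (1 - ?b)" "0 \<le> ?a * ?b"
      using ab by (auto simp: mult_left_le mult_le_cancel_right2 mult_nonneg_nonneg mult_left_le_one_le)
    have m: "?a \<le> ?m" "?m \<le> 1" using ord by (auto simp: algebra_simps)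
    have "?c powr \<beta> \<le> ?m powr \<beta>" using c ab \<beta> by (intro powr_mono2) auto
    moreover have "(?a * ?b) powr \<beta> + ?m powr \<beta> \<le> ?a powr \<beta> + ?b powr \<beta>"
      using concave_on_majorised_pair[OF concave_powr_unit[of \<beta>], of "?a * ?b" ?m ?a ?b] \<beta> ord m ab
      by simp
    ultimately show ?thesis using ab by (simp add: powr_mult algebra_simps)
  qed
  then show ?thesis
    using distort_nonneg_nondeg[OF distortion_powr[OF \<beta>(1)] F]
    by (simp add: class_G_iff tail_def flip: powr_survival_eq_distort)
qed

section \<open>Hazard rate and likelihood ratio orders\<close>

text \<open>The conventions on zeros disappear in this product form: at a point with \<open>u = 0 < v\<close> the ratio is
  infinite, hence remains so at all later points where it is defined, and \<open>u\<close> vanishes at all later points.\<close>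

lemma ratio_increasing_cross:
  assumes "ratio_increasing u v" "\<And>x. 0 \<le> u x" "\<And>x. 0 \<le> v x" "s \<le> t"
  shows "v s * u t \<le> u s * v t"
proof (cases "u t = 0 \<or> v s = 0")
  case True
  then show ?thesis using assms(2,3) by auto
next
  case False
  then have pos: "0 < u t" "0 < v s" using assms(2)[of t] assms(3)[of s] by auto
  then have le: "ereal (v s) / ereal (u s) \<le> ereal (v t) / ereal (u t)"
    by (intro mono_onD[OF assms(1)[unfolded ratio_increasing_def]]) (use pos assms(4) in auto)
  have "0 < u s"
  proof (rule ccontr)
    assume "\<not> 0 < u s"
    then have "u s = 0" using assms(2)[of s] by simp
    then show False using le pos by simp
  qed
  then show ?thesis using le pos by (simp add: field_simps)
qed

lemma has_density_increment:
  assumes "distribution_function F" "has_density F f" "a \<le> b"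
  shows "ennreal (F b - F a) = (\<integral>\<^sup>+ t\<in>{a<..b}. ennreal (f t) \<partial>lborel)"
proof -
  have f: "f \<in> borel_measurable borel" and F: "\<And>x. ennreal (F x) = (\<integral>\<^sup>+ t\<in>{..x}. ennreal (f t) \<partial>lborel)"
    using assms by (auto simp: has_density_def)
  have F0: "0 \<le> F x" for x using distribution_function_bounds[OF assms(1)] by simp
  have "ennreal (F b) = (\<integral>\<^sup>+ t\<in>{..a} \<union> {a<..b}. ennreal (f t) \<partial>lborel)"
    using assms(3) by (simp add: F ivl_disj_un)
  also have "\<dots> = ennreal (F a) + (\<integral>\<^sup>+ t\<in>{a<..b}. ennreal (f t) \<partial>lborel)"
    unfolding F using f by (intro nn_integral_disjoint_pair) auto
  finally have "(\<integral>\<^sup>+ t\<in>{a<..b}. ennreal (f t) \<partial>lborel) = ennreal (F b) - ennreal (F a)"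
    by (simp add: ennreal_minus_if)
  then show ?thesis using F0[of a] by (simp add: ennreal_minus)
qed

text \<open>Integrate \<open>g(s) f(t) \<le> f(s) g(t)\<close> over \<open>s \<in> (a, b]\<close> and \<open>t \<in> (b, c]\<close>. The inequality says that
  \<open>G\<close> is a convex function of \<open>F\<close>.\<close>

lemma lr_le_increments:
  assumes dF: "distribution_function F" and dG: "distribution_function G"
    and lr: "lr_le F G" and ab: "a \<le> b" and bc: "b \<le> c"
  shows "(G b - G a) * (F c - F b) \<le> (F b - F a) * (G c - G b)"
proof -
  obtain f g where fF: "has_density F f" and gG: "has_density G g" and ratio: "ratio_increasing f g"
    using lr by (auto simp: lr_le_def)
  have [measurable]: "f \<in> borel_measurable borel" "g \<in> borel_measurable borel"
    and pos: "\<And>x. 0 \<le> f x" "\<And>x. 0 \<le> g x"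
    using fF gG by (auto simp: has_density_def)
  have cross: "ennreal (g s) * ennreal (f t) \<le> ennreal (f s) * ennreal (g t)" if "s \<le> t" for s t
    using ratio_increasing_cross[OF ratio pos that] pos by (simp flip: ennreal_mult)
  let ?I = "indicator {a<..b} :: real \<Rightarrow> ennreal" and ?J = "indicator {b<..c} :: real \<Rightarrow> ennreal"
  let ?f = "\<lambda>x. ennreal (f x)" and ?g = "\<lambda>x. ennreal (g x)"
  have swap: "(\<integral>\<^sup>+ s. \<integral>\<^sup>+ t. p s * ?I s * (q t * ?J t) \<partial>lborel \<partial>lborel)
      = (\<integral>\<^sup>+ s. p s * ?I s \<partial>lborel) * (\<integral>\<^sup>+ t. q t * ?J t \<partial>lborel)"
    if [measurable]: "p \<in> borel_measurable borel" "q \<in> borel_measurable borel" for p q :: "real \<Rightarrow> ennreal"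
    by (simp add: nn_integral_cmult nn_integral_multc)
  have "(\<integral>\<^sup>+ s. ?g s * ?I s \<partial>lborel) * (\<integral>\<^sup>+ t. ?f t * ?J t \<partial>lborel)
      = (\<integral>\<^sup>+ s. \<integral>\<^sup>+ t. ?g s * ?I s * (?f t * ?J t) \<partial>lborel \<partial>lborel)"
    by (rule swap[symmetric]) auto
  also have "\<dots> \<le> (\<integral>\<^sup>+ s. \<integral>\<^sup>+ t. ?f s * ?I s * (?g t * ?J t) \<partial>lborel \<partial>lborel)"
    by (intro nn_integral_mono) (auto simp: indicator_def intro: cross)
  also have "\<dots> = (\<integral>\<^sup>+ s. ?f s * ?I s \<partial>lborel) * (\<integral>\<^sup>+ t. ?g t * ?J t \<partial>lborel)"
    by (rule swap) auto
  finally have "ennreal (G b - G a) * ennreal (F c - F b) \<le> ennreal (F b - F a) * ennreal (G c - G b)"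
    using has_density_increment[OF dF fF] has_density_increment[OF dG gG] ab bc by simp
  moreover have "0 \<le> G b - G a" "0 \<le> F c - F b" "0 \<le> F b - F a" "0 \<le> G c - G b"
    using monoD[OF distribution_functionD(1)[OF dF]] monoD[OF distribution_functionD(1)[OF dG]] ab bc
    by auto
  ultimately show ?thesis by (simp flip: ennreal_mult)
qed

text \<open>The limit \<open>c \<rightarrow> \<infinity>\<close> of the preceding inequality. It is the product form of the hazard rate order.\<close>

lemma lr_le_survival_cross:
  assumes dF: "distribution_function F" and dG: "distribution_function G"
    and lr: "lr_le F G" and ab: "a \<le> b"
  shows "survival G a * survival F b \<le> survival F a * survival G b"
proof -
  have "(G b - G a) * (1 - F b) \<le> (F b - F a) * (1 - G b)"
  proof (rule tendsto_le[OF trivial_limit_at_top_linorder])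
    show "((\<lambda>c. (F b - F a) * (G c - G b)) \<longlongrightarrow> (F b - F a) * (1 - G b)) at_top"
      by (intro tendsto_intros distribution_functionD(4)[OF dG])
    show "((\<lambda>c. (G b - G a) * (F c - F b)) \<longlongrightarrow> (G b - G a) * (1 - F b)) at_top"
      by (intro tendsto_intros distribution_functionD(4)[OF dF])
    show "eventually (\<lambda>c. (G b - G a) * (F c - F b) \<le> (F b - F a) * (G c - G b)) at_top"
      using eventually_ge_at_top[of b] by eventually_elim (rule lr_le_increments[OF dF dG lr ab])
  qed
  then show ?thesis by (simp add: survival_def algebra_simps)
qed

lemma hr_le_survival_cross:
  assumes "distribution_function F" "distribution_function G" "hr_le F G" "a \<le> b"
  shows "survival G a * survival F b \<le> survival F a * survival G b"
  using ratio_increasing_cross[of "survival F" "survival G" a b] assms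
    distribution_function_bounds
  by (simp add: hr_le_def survival_def)

text \<open>The product form of the hazard rate order for negative \<open>a \<le> b\<close> says that the survival function
  of \<open>G\<close> is increasing there, so that it equals its limit 1 at \<open>-\<infinity>\<close>. A point mass at \<open>c\<close> is
  impossible for \<open>G\<close> because its survival function drops from 1 to 0 at \<open>c\<close>, which would force that
  of \<open>F\<close> to vanish at \<open>c\<close>.\<close>

lemma survival_cross_nonneg_nondeg:
  assumes F: "F \<in> class_Hstar" and dG: "distribution_function G"
    and cross: "\<And>a b. a \<le> b \<Longrightarrow> survival G a * survival F b \<le> survival F a * survival G b"
  shows "G \<in> nonneg_nondeg"
proof -
  have F0: "F x = 0" if "x < 0" for x
    using F that by (simp add: class_Hstar_iff nonneg_nondeg_iff)
  note G01 = distribution_function_bounds[OF dG]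
  have G0: "G b = 0" if "b < 0" for b
  proof -
    have "G b \<le> G a" if "a \<le> b" for a
      using cross[OF that] F0 \<open>b < 0\<close> that by (simp add: survival_def)
    then have "eventually (\<lambda>a. G b \<le> G a) at_bot"
      unfolding eventually_at_bot_linorder by blast
    then have "G b \<le> 0"
      using tendsto_lowerbound[OF distribution_functionD(3)[OF dG]] trivial_limit_at_bot_linorder by blast
    then show ?thesis using G01(1)[of b] by simp
  qed
  have "\<not> degenerate G"
  proof
    assume "degenerate G"
    then obtain c where c: "G = cdf (return borel c)" by (auto simp: degenerate_def)
    have "survival F c \<le> 0" using cross[of "c - 1" c] by (simp add: c cdf_point_mass survival_def)
    then show False using survival_pos[OF F, of c] by simp
  qed
  then have "\<exists>x. 0 < G x \<and> G x < 1"
    unfolding degenerate_iff_zero_one[OF dG] using G01 by (metis less_eq_real_def)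
  then show ?thesis using dG G0 by (simp add: nonneg_nondeg_iff)
qed

text \<open>The ratio of the tails of \<open>G\<close> and \<open>F\<close> at \<open>u + v\<close> is at most the ratio at \<open>u\<close> and the one at \<open>v\<close>, because
  the reciprocal reverses the order. The product form avoids the division until the common factor, the
  tail of \<open>F\<close> at \<open>u + v\<close>, is cancelled.\<close>

lemma survival_cross_class_Hstar:
  assumes F: "F \<in> class_Hstar" and dG: "distribution_function G"
    and cross: "\<And>a b. a \<le> b \<Longrightarrow> survival G a * survival F b \<le> survival F a * survival G b"
  shows "G \<in> class_Hstar"
proof -
  have G: "G \<in> nonneg_nondeg" using survival_cross_nonneg_nondeg[OF assms] .
  have "tail G (u + v) \<le> tail G u + tail G v" if uv: "0 < u" "0 < v" for u v
  proof -
    have c: "tail G (u + v) * tail F w \<le> tail F (u + v) * tail G w" if "0 < w" "w \<le> u + v" for w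
      unfolding tail_def using that by (intro cross) (simp add: frac_le)
    have "tail G (u + v) * tail F (u + v) \<le> tail G (u + v) * (tail F u + tail F v)"
      using F uv tail_bounds[OF G] by (intro mult_left_mono) (auto simp: class_Hstar_iff)
    also have "\<dots> \<le> tail F (u + v) * tail G u + tail F (u + v) * tail G v"
      using c[of u] c[of v] uv by (simp add: distrib_left)
    finally have "tail F (u + v) * tail G (u + v) \<le> tail F (u + v) * (tail G u + tail G v)"
      by (simp add: algebra_simps)
    then show ?thesis using tail_pos[OF F, of "u + v"] uv by simp
  qed
  then show ?thesis using G by (simp add: class_Hstar_iff)
qed

lemma survival_cross_class_V:
  assumes F: "F \<in> class_V" and dG: "distribution_function G"
    and cross: "\<And>a b. a \<le> b \<Longrightarrow> survival G a * survival F b \<le> survival F a * survival G b"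
  shows "G \<in> class_V"
proof -
  have Fs: "F \<in> class_Hstar" using F class_V_subset_class_Hstar by blast
  have G: "G \<in> nonneg_nondeg" using survival_cross_nonneg_nondeg[OF Fs dG cross] .
  have "\<theta> * tail G u \<le> tail G (\<theta> * u)" if u: "0 < u" and \<theta>: "\<theta> \<in> {0<..<1}" for u \<theta>
  proof -
    have "tail F u * (\<theta> * tail G u) = tail G u * (\<theta> * tail F u)" by simp
    also have "\<dots> \<le> tail G u * tail F (\<theta> * u)"
      using F u \<theta> tail_bounds[OF G] by (intro mult_left_mono) (auto simp: class_V_iff)
    also have "\<dots> \<le> tail F u * tail G (\<theta> * u)"
      unfolding tail_def using u \<theta> by (intro cross) (simp add: frac_le mult_left_le_one_le)
    finally show ?thesis using tail_pos[OF Fs u] by simp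
  qed
  then show ?thesis using G by (simp add: class_V_iff)
qed

text \<open>Concavity says that slopes decrease from the interval \<open>[x, z]\<close> to \<open>[z, y]\<close>. This holds for the tail
  of \<open>F\<close>, and the increments of the tail of \<open>G\<close> relative to those of \<open>F\<close> also decrease
  (\<open>lr_le_increments\<close> at the reciprocal points), so the product of the two comparisons gives the
  claim.\<close>

lemma lr_le_class_H:
  assumes F: "F \<in> class_H" and dG: "distribution_function G" and lr: "lr_le F G"
  shows "G \<in> class_H"
proof -
  have Fs: "F \<in> class_Hstar"
    using F class_H_subset_class_V class_V_subset_class_Hstar by blast
  have F0: "F \<in> nonneg_nondeg" and conc: "concave_on {0<..} (tail F)"
    using F by (auto simp: class_H_iff)
  have dF: "distribution_function F" using F0 by (simp add: nonneg_nondeg_iff)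
  note cross = lr_le_survival_cross[OF dF dG lr]
  have G: "G \<in> nonneg_nondeg" using survival_cross_nonneg_nondeg[OF Fs dG cross] .
  have "concave_on {0<..} (tail G)"
  proof (rule concave_on_linorderI)
    fix t x y :: real
    assume t: "0 < t" "t < 1" and "x \<in> {0<..}" "y \<in> {0<..}" "x < y"
    then have xy: "0 < x" "x < y" "0 < y" by auto
    define z where "z = (1 - t) *\<^sub>R x + t *\<^sub>R y"
    have "z - x = t * (y - x)" "y - z = (1 - t) * (y - x)" by (auto simp: z_def algebra_simps)
    then have "0 < z - x" "0 < y - z" using t xy by auto
    then have z: "x < z" "z < y" "0 < z" using xy by auto
    then have inv: "1 / y \<le> 1 / z" "1 / z \<le> 1 / x" using xy by (auto intro: frac_le)
    (* 1 and 2 refer to the increments over [x, z] and [z, y]. *)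
    define F1 where "F1 = tail F z - tail F x"
    define F2 where "F2 = tail F y - tail F z"
    define G1 where "G1 = tail G z - tail G x"
    define G2 where "G2 = tail G y - tail G z"
    have nonneg: "0 \<le> F1" "0 \<le> F2" "0 \<le> G1" "0 \<le> G2"
      using tail_mono[OF F0] tail_mono[OF G] z xy by (auto simp: F1_def F2_def G1_def G2_def)
    have incr: "G2 * F1 \<le> F2 * G1"
      using lr_le_increments[OF dF dG lr inv]
      by (simp add: F1_def F2_def G1_def G2_def tail_def survival_def)
    have "(1 - t) * tail F x + t * tail F y \<le> tail F z"
      unfolding z_def using concave_onD[OF conc] t xy by simp
    then have slope: "t * F2 \<le> (1 - t) * F1" by (simp add: F1_def F2_def algebra_simps)
    have "t * G2 \<le> (1 - t) * G1"
    (* If the tail of F is flat on [x, z], it is flat on [z, y] by concavity, and the comparison of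
       increments is void. That the tail of G is flat on [z, y] follows from the product form of the
       hazard rate order, since the tail of F does not vanish at z. *)
    proof (cases "F1 = 0")
      case True
      then have "F2 = 0" using slope nonneg(2) t by (simp add: mult_le_0_iff)
      moreover have "tail G y * tail F z \<le> tail F y * tail G z"
        unfolding tail_def by (rule cross[OF inv(1)])
      ultimately have "tail F z * tail G y \<le> tail F z * tail G z" by (simp add: F2_def mult.commute)
      then have "G2 \<le> 0" using tail_pos[OF Fs z(3)] by (simp add: G2_def)
      then show ?thesis using nonneg t by simp
    next
      case False
      have "F1 * (t * G2) \<le> (t * F2) * G1"
        using mult_left_mono[OF incr, of t] t by (simp add: algebra_simps)
      also have "\<dots> \<le> ((1 - t) * F1) * G1" using slope nonneg by (intro mult_right_mono)
      finally have "F1 * (t * G2) \<le> F1 * ((1 - t) * G1)" by (simp add: algebra_simps)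
      then show ?thesis using False nonneg by simp
    qed
    then show "(1 - t) * tail G x + t * tail G y \<le> tail G ((1 - t) *\<^sub>R x + t *\<^sub>R y)"
      unfolding z_def[symmetric] by (simp add: G1_def G2_def algebra_simps)
  qed simp
  then show ?thesis using G by (simp add: class_H_iff)
qed

section \<open>Mixtures\<close>

definition mixture :: "'i set \<Rightarrow> ('i \<Rightarrow> real) \<Rightarrow> ('i \<Rightarrow> real \<Rightarrow> real) \<Rightarrow> real \<Rightarrow> real" where
  "mixture I w F x = (\<Sum>i\<in>I. w i * F i x)"

lemma tail_mixture:
  assumes "(\<Sum>i\<in>I. w i) = 1"
  shows "tail (mixture I w F) u = (\<Sum>i\<in>I. w i * tail (F i) u)"
  using assms by (simp add: tail_def survival_def mixture_def sum_subtractf right_diff_distrib)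

lemma mixture_nonneg_nondeg:
  assumes w: "\<And>i. i \<in> I \<Longrightarrow> 0 \<le> w i" "(\<Sum>i\<in>I. w i) = 1"
    and F: "\<And>i. i \<in> I \<Longrightarrow> F i \<in> nonneg_nondeg"
  shows "mixture I w F \<in> nonneg_nondeg"
proof -
  (* A sum over an infinite set is 0 by convention. *)
  have fin: "finite I" using w(2) by (metis sum.infinite zero_neq_one)
  have dF: "distribution_function (F i)" if "i \<in> I" for i
    using F[OF that] by (simp add: nonneg_nondeg_iff)
  note D = distribution_functionD[OF dF]
  have "distribution_function (mixture I w F)"
  proof (rule distribution_functionI)
    show "mono (mixture I w F)"
      unfolding mixture_def by (intro monoI sum_mono mult_left_mono w monoD[OF D(1)])
    show "continuous (at_right a) (mixture I w F)" for a
      unfolding mixture_def[abs_def] by (intro continuous_intros D(2))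
    have "((\<lambda>x. \<Sum>i\<in>I. w i * F i x) \<longlongrightarrow> (\<Sum>i\<in>I. w i * 0)) at_bot"
      by (intro tendsto_intros D(3))
    then show "(mixture I w F \<longlongrightarrow> 0) at_bot" by (simp add: mixture_def[abs_def])
    have "((\<lambda>x. \<Sum>i\<in>I. w i * F i x) \<longlongrightarrow> (\<Sum>i\<in>I. w i * 1)) at_top"
      by (intro tendsto_intros D(4))
    then show "(mixture I w F \<longlongrightarrow> 1) at_top" by (simp add: mixture_def[abs_def] w(2))
  qed
  moreover have "\<exists>x. 0 < mixture I w F x \<and> mixture I w F x < 1"
  proof -
    obtain i where i: "i \<in> I" "0 < w i"
      using w by (metis less_eq_real_def sum.neutral zero_neq_one)
    obtain x where x: "0 < F i x" "F i x < 1" using F[OF i(1)] by (auto simp: nonneg_nondeg_iff)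
    have B: "0 \<le> F j x" "F j x \<le> 1" if "j \<in> I" for j
      using distribution_function_bounds[OF dF[OF that]] by auto
    have "0 < mixture I w F x"
      unfolding mixture_def using i x B w by (intro sum_pos2[OF fin i(1)]) auto
    moreover have "(\<Sum>j\<in>I. w j * F j x) < (\<Sum>j\<in>I. w j)"
    proof (rule sum_strict_mono_ex1[OF fin])
      show "\<forall>j\<in>I. w j * F j x \<le> w j" using B w by (auto intro: mult_left_le)
      show "\<exists>j\<in>I. w j * F j x < w j" using i x by (intro bexI[of _ i]) auto
    qed
    ultimately show ?thesis using w(2) by (auto simp: mixture_def)
  qed
  moreover have "\<forall>x<0. mixture I w F x = 0"
    using F by (simp add: mixture_def nonneg_nondeg_iff)
  ultimately show ?thesis by (simp add: nonneg_nondeg_iff)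
qed

lemma mixture_class_V:
  assumes w: "\<And>i. i \<in> I \<Longrightarrow> 0 \<le> w i" "(\<Sum>i\<in>I. w i) = 1"
    and F: "\<And>i. i \<in> I \<Longrightarrow> F i \<in> class_V"
  shows "mixture I w F \<in> class_V"
proof -
  have "\<theta> * (\<Sum>i\<in>I. w i * tail (F i) u) \<le> (\<Sum>i\<in>I. w i * tail (F i) (\<theta> * u))"
    if "0 < u" "\<theta> \<in> {0<..<1}" for u \<theta>
    unfolding sum_distrib_left
  proof (rule sum_mono)
    fix i assume i: "i \<in> I"
    have "w i * (\<theta> * tail (F i) u) \<le> w i * tail (F i) (\<theta> * u)"
      using F[OF i] w(1)[OF i] that by (intro mult_left_mono) (auto simp: class_V_iff)
    then show "\<theta> * (w i * tail (F i) u) \<le> w i * tail (F i) (\<theta> * u)" by (simp add: mult.left_commute)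
  qed
  then show ?thesis
    using mixture_nonneg_nondeg[of I w F] w F by (simp add: class_V_iff tail_mixture)
qed

lemma mixture_class_Hstar:
  assumes w: "\<And>i. i \<in> I \<Longrightarrow> 0 \<le> w i" "(\<Sum>i\<in>I. w i) = 1"
    and F: "\<And>i. i \<in> I \<Longrightarrow> F i \<in> class_Hstar"
  shows "mixture I w F \<in> class_Hstar"
proof -
  have "(\<Sum>i\<in>I. w i * tail (F i) (u + v)) \<le> (\<Sum>i\<in>I. w i * tail (F i) u) + (\<Sum>i\<in>I. w i * tail (F i) v)"
    if "0 < u" "0 < v" for u v
    unfolding sum.distrib[symmetric] distrib_left[symmetric]
    using F w that by (intro sum_mono mult_left_mono) (auto simp: class_Hstar_iff)
  then show ?thesis
    using mixture_nonneg_nondeg[of I w F] w F by (simp add: class_Hstar_iff tail_mixture)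
qed

lemma mixture_class_H:
  assumes w: "\<And>i. i \<in> I \<Longrightarrow> 0 \<le> w i" "(\<Sum>i\<in>I. w i) = 1"
    and F: "\<And>i. i \<in> I \<Longrightarrow> F i \<in> class_H"
  shows "mixture I w F \<in> class_H"
proof -
  have "concave_on {0<..} (\<lambda>u. \<Sum>i\<in>I. w i * tail (F i) u)"
  proof (rule concave_on_linorderI)
    fix t x y :: real
    assume t: "0 < t" "t < 1" and xy: "x \<in> {0<..}" "y \<in> {0<..}" "x < y"
    have "(1 - t) * (w i * tail (F i) x) + t * (w i * tail (F i) y)
        \<le> w i * tail (F i) ((1 - t) *\<^sub>R x + t *\<^sub>R y)" if i: "i \<in> I" for i
    proof -
      have "(1 - t) * tail (F i) x + t * tail (F i) y \<le> tail (F i) ((1 - t) *\<^sub>R x + t *\<^sub>R y)"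
        using F[OF i] t xy by (intro concave_onD) (auto simp: class_H_iff)
      from mult_left_mono[OF this w(1)[OF i]] show ?thesis by (simp add: algebra_simps)
    qed
    then show "(1 - t) * (\<Sum>i\<in>I. w i * tail (F i) x) + t * (\<Sum>i\<in>I. w i * tail (F i) y)
        \<le> (\<Sum>i\<in>I. w i * tail (F i) ((1 - t) *\<^sub>R x + t *\<^sub>R y))"
      unfolding sum_distrib_left sum.distrib[symmetric] by (rule sum_mono)
  qed simp
  moreover have "tail (mixture I w F) = (\<lambda>u. \<Sum>i\<in>I. w i * tail (F i) u)"
    using tail_mixture[OF w(2)] by (simp add: fun_eq_iff)
  ultimately show ?thesis
    using mixture_nonneg_nondeg[of I w F] w F by (simp add: class_H_iff)
qed

text \<open>Twice the difference of the two sides is the sum of \<open>w\<^sub>i w\<^sub>j (a\<^sub>i - a\<^sub>j) (b\<^sub>i - b\<^sub>j)\<close> over all pairs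
  of indices.\<close>

lemma weighted_Chebyshev_sum:
  fixes a b w :: "'i \<Rightarrow> real"
  assumes w: "\<And>i. i \<in> I \<Longrightarrow> 0 \<le> w i" "(\<Sum>i\<in>I. w i) = 1"
    and mono: "\<And>i j. i \<in> I \<Longrightarrow> j \<in> I \<Longrightarrow> 0 \<le> (a i - a j) * (b i - b j)"
  shows "(\<Sum>i\<in>I. w i * a i) * (\<Sum>i\<in>I. w i * b i) \<le> (\<Sum>i\<in>I. w i * (a i * b i))"
proof -
  let ?A = "\<Sum>i\<in>I. w i * a i" and ?B = "\<Sum>i\<in>I. w i * b i" and ?C = "\<Sum>i\<in>I. w i * (a i * b i)"
  have "0 \<le> (\<Sum>i\<in>I. \<Sum>j\<in>I. w i * w j * ((a i - a j) * (b i - b j)))"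
    using w(1) mono by (intro sum_nonneg mult_nonneg_nonneg[OF mult_nonneg_nonneg]) auto
  also have "\<dots> = (\<Sum>i\<in>I. \<Sum>j\<in>I. (w i * (a i * b i)) * w j + w i * (w j * (a j * b j))
      - (w i * a i) * (w j * b j) - (w i * b i) * (w j * a j))"
    by (intro sum.cong refl) (simp add: algebra_simps)
  also have "\<dots> = ?C * (\<Sum>i\<in>I. w i) + (\<Sum>i\<in>I. w i) * ?C - ?A * ?B - ?B * ?A"
    by (simp only: sum.distrib sum_subtractf sum_product)
  finally show ?thesis using w(2) by (simp add: mult.commute)
qed

lemma mixture_class_G:
  fixes F :: "'i::linorder \<Rightarrow> real \<Rightarrow> real"
  assumes w: "\<And>i. i \<in> I \<Longrightarrow> 0 \<le> w i" "(\<Sum>i\<in>I. w i) = 1"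
    and F: "\<And>i. i \<in> I \<Longrightarrow> F i \<in> class_G"
    and st: "\<And>i j. i \<in> I \<Longrightarrow> j \<in> I \<Longrightarrow> i \<le> j \<Longrightarrow> st_le (F i) (F j)"
  shows "mixture I w F \<in> class_G"
proof -
  have "mixture I w F (1 / x) * mixture I w F (1 / y) \<le> mixture I w F (1 / (x + y))"
    if xy: "0 < x" "0 < y" for x y
  proof -
    have "mixture I w F (1 / x) * mixture I w F (1 / y) \<le> (\<Sum>i\<in>I. w i * (F i (1 / x) * F i (1 / y)))"
      unfolding mixture_def
    proof (rule weighted_Chebyshev_sum[OF w])
      fix i j assume ij: "i \<in> I" "j \<in> I"
      show "0 \<le> (F i (1 / x) - F j (1 / x)) * (F i (1 / y) - F j (1 / y))"
        using st[OF ij] st[OF ij(2,1)] linear[of i j]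
        by (auto simp: st_le_def survival_def intro: mult_nonneg_nonneg mult_nonpos_nonpos)
    qed
    also have "\<dots> \<le> mixture I w F (1 / (x + y))"
      unfolding mixture_def using F w xy
      by (intro sum_mono mult_left_mono) (auto simp: class_G_iff)
    finally show ?thesis .
  qed
  then show ?thesis
    using mixture_nonneg_nondeg[of I w F] w F by (simp add: class_G_iff)
qed

section \<open>Examples separating the classes\<close>

text \<open>Inverts the passage to the reciprocal tail for distributions without an atom at 0, which are those
  whose tail tends to 1 at infinity.\<close>

definition from_tail :: "(real \<Rightarrow> real) \<Rightarrow> real \<Rightarrow> real" where
  "from_tail \<phi> x = (if x \<le> 0 then 0 else 1 - \<phi> (1 / x))"

lemma tail_from_tail: "0 < u \<Longrightarrow> tail (from_tail \<phi>) u = \<phi> u"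
  by (simp add: tail_def survival_def from_tail_def)

text \<open>The distribution function vanishes to the left of \<open>1 / k\<close>, which disposes of continuity at 0, and
  it tends to 1 at \<open>\<infinity>\<close> because the tail tends to 0 at 0. The intermediate value theorem provides a
  point where it is \<open>1 / 2\<close>.\<close>

lemma from_tail_nonneg_nondeg:
  assumes mono: "\<And>x y. 0 \<le> x \<Longrightarrow> x \<le> y \<Longrightarrow> \<phi> x \<le> \<phi> y"
    and cont: "continuous_on {0..} \<phi>" and zero: "\<phi> 0 = 0"
    and k: "0 < k" and one: "\<And>x. k \<le> x \<Longrightarrow> \<phi> x = 1"
  shows "from_tail \<phi> \<in> nonneg_nondeg"
proof -
  have le1: "\<phi> x \<le> 1" if "0 \<le> x" for x
    using mono[of x "max x k"] one[of "max x k"] that by simp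
  have at0: "from_tail \<phi> x = 0" if "x < 1 / k" for x
  proof (cases "x \<le> 0")
    case False
    then have "k \<le> 1 / x" using that k by (simp add: field_simps)
    then show ?thesis using one by (simp add: from_tail_def)
  qed (simp add: from_tail_def)
  have "distribution_function (from_tail \<phi>)"
  proof (rule distribution_functionI)
    show "mono (from_tail \<phi>)"
    proof (rule monoI)
      fix x y :: real assume xy: "x \<le> y"
      show "from_tail \<phi> x \<le> from_tail \<phi> y"
      proof (cases "x \<le> 0")
        case True
        then show ?thesis using le1[of "1 / y"] by (simp add: from_tail_def)
      next
        case False
        then have "1 / y \<le> 1 / x" using xy by (intro frac_le) auto
        then show ?thesis using mono[of "1 / y" "1 / x"] False xy by (simp add: from_tail_def)
      qed
    qed
    show "continuous (at_right a) (from_tail \<phi>)" for a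
    proof (cases "a < 1 / k")
      case True
      have "eventually (\<lambda>x. x < 1 / k) (at_right a)"
        using True eventually_at_right by blast
      then have "eventually (\<lambda>x. from_tail \<phi> x = 0) (at_right a)"
        by eventually_elim (rule at0)
      then show ?thesis
        using at0[OF True] by (simp add: continuous_within tendsto_eventually)
    next
      case False
      then have a: "0 < a" using k by (smt (verit) divide_pos_pos)
      have "continuous_on {0<..} (\<lambda>x. 1 - \<phi> (1 / x))"
        by (intro continuous_intros continuous_on_compose2[OF cont]) auto
      then have "isCont (\<lambda>x. 1 - \<phi> (1 / x)) a"
        using a by (simp add: continuous_on_eq_continuous_at)
      moreover have "eventually (\<lambda>x. from_tail \<phi> x = 1 - \<phi> (1 / x)) (nhds a)"
        using a eventually_nhds_in_open[of "{0<..}" a]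
        by (auto elim!: eventually_mono simp: from_tail_def)
      ultimately have "isCont (from_tail \<phi>) a" by (simp add: isCont_cong)
      then show ?thesis using continuous_at_imp_continuous_at_within by blast
    qed
    have "eventually (\<lambda>x. from_tail \<phi> x = 0) at_bot"
      using eventually_le_at_bot[of 0] by eventually_elim (simp add: from_tail_def)
    then show "(from_tail \<phi> \<longlongrightarrow> 0) at_bot" by (rule tendsto_eventually)
    have inv: "((\<lambda>x::real. 1 / x) \<longlongrightarrow> 0) at_top" 
      by (intro tendsto_divide_0[OF tendsto_const] filterlim_at_top_imp_at_infinity filterlim_ident)
    have "((\<lambda>x. 1 - \<phi> (1 / x)) \<longlongrightarrow> 1 - \<phi> 0) at_top"
    proof (intro tendsto_intros continuous_on_tendsto_compose[OF cont inv])
      show "eventually (\<lambda>x::real. 1 / x \<in> {0..}) at_top"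
        using eventually_ge_at_top[of 0] by eventually_elim simp
    qed simp
    moreover have "eventually (\<lambda>x. 1 - \<phi> (1 / x) = from_tail \<phi> x) at_top"
      using eventually_gt_at_top[of 0] by eventually_elim (simp add: from_tail_def)
    ultimately show "(from_tail \<phi> \<longlongrightarrow> 1) at_top" using zero by (simp add: tendsto_cong)
  qed
  moreover have "\<exists>x. 0 < from_tail \<phi> x \<and> from_tail \<phi> x < 1"
  proof -
    obtain x where x: "0 \<le> x" "\<phi> x = 1 / 2"
      using IVT'[of \<phi> 0 "1 / 2" k] zero one[of k] k continuous_on_subset[OF cont, of "{0..k}"] by auto
    moreover have "x \<noteq> 0" using x zero by auto
    ultimately have "from_tail \<phi> (1 / x) = 1 / 2" by (simp add: from_tail_def)
    then show ?thesis by (intro exI[of _ "1 / x"]) simp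
  qed
  moreover have "\<forall>x<0. from_tail \<phi> x = 0" by (simp add: from_tail_def)
  ultimately show ?thesis by (simp add: nonneg_nondeg_iff)
qed

text \<open>Half of a function that rises with slope 1 on \<open>[0, 1]\<close> and \<open>[2, 3]\<close> and is constant elsewhere.
  Its slope seen from the origin increases between 2 and 3, which excludes \<open>\<V>\<close>. On
  \<open>[0, 1]\<close> subadditivity is an equality, which leaves no room for the product term that \<open>\<G>\<close>
  requires.\<close>

definition staircase :: "real \<Rightarrow> real" where
  "staircase u = min u (max 1 (min (u - 1) 2)) / 2"

lemma staircase_class_Hstar: "from_tail staircase \<in> class_Hstar"
proof -
  have "from_tail staircase \<in> nonneg_nondeg"
    by (rule from_tail_nonneg_nondeg[of _ 3])
      (auto simp: staircase_def[abs_def] intro!: continuous_intros)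
  moreover have "staircase (u + v) \<le> staircase u + staircase v" if "0 < u" "0 < v" for u v
    using that by (simp add: staircase_def min_def max_def)
  ultimately show ?thesis by (simp add: class_Hstar_iff tail_from_tail)
qed

lemma staircase_not_class_V: "from_tail staircase \<notin> class_V"
proof
  assume "from_tail staircase \<in> class_V"
  then have "\<forall>u>0. \<forall>\<theta>\<in>{0<..<1}. \<theta> * tail (from_tail staircase) u \<le> tail (from_tail staircase) (\<theta> * u)"
    by (simp add: class_V_iff)
  (* The values at 3 and 2 are 1 and 1 / 2, and 1 / 2 < 2 / 3. *)
  from this[rule_format, of 3 "2 / 3"] show False by (simp add: tail_from_tail staircase_def)
qed

lemma staircase_not_class_G: "from_tail staircase \<notin> class_G"
proof
  assume "from_tail staircase \<in> class_G"
  then have "\<forall>x>0. \<forall>y>0. from_tail staircase (1 / x) * from_tail staircase (1 / y)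
      \<le> from_tail staircase (1 / (x + y))"
    by (simp add: class_G_iff)
  from this[rule_format, of "1 / 2" "1 / 2"] show False by (simp add: from_tail_def staircase_def)
qed

text \<open>The maximum of two star-shaped functions is star-shaped, whereas that of two concave functions need
  not be concave: this one is constant on \<open>[1/2, 1]\<close> and increases again on \<open>[1, 2]\<close>.\<close>

definition kinked :: "real \<Rightarrow> real" where
  "kinked u = max (min u (1 / 2)) (min (u / 2) 1)"

lemma kinked_class_V: "from_tail kinked \<in> class_V"
proof -
  have "from_tail kinked \<in> nonneg_nondeg"
    by (rule from_tail_nonneg_nondeg[of _ 2])
      (auto simp: kinked_def[abs_def] intro!: continuous_intros)
  moreover have "\<theta> * kinked u \<le> kinked (\<theta> * u)" if "0 < u" "\<theta> \<in> {0<..<1}" for u \<theta>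
    using that by (auto simp: kinked_def max_mult_distrib_left min_mult_distrib_left) 
  ultimately show ?thesis by (simp add: class_V_iff tail_from_tail)
qed

lemma kinked_not_class_H: "from_tail kinked \<notin> class_H"
proof
  assume "from_tail kinked \<in> class_H"
  then have "concave_on {0<..} (tail (from_tail kinked))" by (simp add: class_H_iff)
  (* 1 = 2/3 * 1/2 + 1/3 * 2 is the convex kink. *)
  from concave_onD[OF this, of "1 / 3" "1 / 2" 2] show False
    by (simp add: tail_from_tail kinked_def)
qed

section \<open>Relations between the classes and their closure properties\<close>

theorem proposition3p3:
  shows
    \<comment> \<open>(i)\<close>
    "(class_G \<subset> class_Hstar \<and> class_H \<subset> class_V \<and> class_V \<subset> class_Hstar) \<and>
    \<comment> \<open>(ii)\<close>
     ((\<forall>F\<in>class_H. \<forall>\<beta>\<ge>1. (\<lambda>x. F x powr \<beta>) \<in> class_H) \<and>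
      (\<forall>F\<in>class_G. \<forall>\<beta>>0. (\<lambda>x. F x powr \<beta>) \<in> class_G) \<and>
      (\<forall>F\<in>class_V. \<forall>\<beta>\<ge>1. (\<lambda>x. F x powr \<beta>) \<in> class_V) \<and>
      (\<forall>F\<in>class_Hstar. \<forall>\<beta>\<ge>1. (\<lambda>x. F x powr \<beta>) \<in> class_Hstar)) \<and>
    \<comment> \<open>(iii)\<close>
     ((\<forall>F\<in>class_V. \<forall>\<beta>\<in>{0<..<1}. (\<lambda>x. 1 - survival F x powr \<beta>) \<in> class_V) \<and>
      (\<forall>F\<in>class_H. \<forall>\<beta>\<in>{0<..<1}. (\<lambda>x. 1 - survival F x powr \<beta>) \<in> class_H) \<and>
      (\<forall>F\<in>class_Hstar. \<forall>\<beta>\<in>{0<..<1}. (\<lambda>x. 1 - survival F x powr \<beta>) \<in> class_Hstar) \<and>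
      (\<forall>F\<in>class_G. \<forall>\<beta>\<in>{0<..<1}. (\<lambda>x. 1 - survival F x powr \<beta>) \<in> class_G)) \<and>
    \<comment> \<open>(iv)\<close>
     ((\<forall>F\<in>class_H. \<forall>G. distribution_function G \<and> lr_le F G \<longrightarrow> G \<in> class_H) \<and>
      (\<forall>F\<in>class_V. \<forall>G. distribution_function G \<and> hr_le F G \<longrightarrow> G \<in> class_V) \<and>
      (\<forall>F\<in>class_Hstar. \<forall>G. distribution_function G \<and> hr_le F G \<longrightarrow> G \<in> class_Hstar)) \<and>
    \<comment> \<open>(v)\<close>
     (\<forall>(n::nat) (w::nat \<Rightarrow> real) (F::nat \<Rightarrow> real \<Rightarrow> real).
        (\<forall>i\<in>{1..n}. 0 \<le> w i) \<and> (\<Sum>i=1..n. w i) = 1 \<longrightarrow>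
          ((\<forall>i\<in>{1..n}. F i \<in> class_V) \<longrightarrow> (\<lambda>x. \<Sum>i=1..n. w i * F i x) \<in> class_V) \<and>
          ((\<forall>i\<in>{1..n}. F i \<in> class_H) \<longrightarrow> (\<lambda>x. \<Sum>i=1..n. w i * F i x) \<in> class_H) \<and>
          ((\<forall>i\<in>{1..n}. F i \<in> class_Hstar) \<longrightarrow>
             (\<lambda>x. \<Sum>i=1..n. w i * F i x) \<in> class_Hstar) \<and>
          ((\<forall>i\<in>{1..n}. F i \<in> class_G) \<and> (\<forall>i\<in>{1..<n}. st_le (F i) (F (i + 1))) \<longrightarrow>
             (\<lambda>x. \<Sum>i=1..n. w i * F i x) \<in> class_G))"
proof (intro conjI)
  show "class_G \<subset> class_Hstar"
    using class_G_subset_class_Hstar staircase_class_Hstar staircase_not_class_G by blast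
  show "class_H \<subset> class_V"
    using class_H_subset_class_V kinked_class_V kinked_not_class_H by blast
  show "class_V \<subset> class_Hstar"
    using class_V_subset_class_Hstar staircase_class_Hstar staircase_not_class_V by blast
next
  show "\<forall>F\<in>class_H. \<forall>\<beta>\<ge>1. (\<lambda>x. F x powr \<beta>) \<in> class_H"
    using distort_class_H[OF distortion_dual_powr concave_dual_powr_unit]
    by (simp add: powr_cdf_eq_distort)
  show "\<forall>F\<in>class_G. \<forall>\<beta>>0. (\<lambda>x. F x powr \<beta>) \<in> class_G"
    using powr_cdf_class_G by blast
  show "\<forall>F\<in>class_V. \<forall>\<beta>\<ge>1. (\<lambda>x. F x powr \<beta>) \<in> class_V"
    using distort_class_V[OF distortion_dual_powr concave_dual_powr_unit]
    by (simp add: powr_cdf_eq_distort)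
  show "\<forall>F\<in>class_Hstar. \<forall>\<beta>\<ge>1. (\<lambda>x. F x powr \<beta>) \<in> class_Hstar"
    using distort_class_Hstar[OF distortion_dual_powr concave_dual_powr_unit]
    by (simp add: powr_cdf_eq_distort)
next
  show "\<forall>F\<in>class_V. \<forall>\<beta>\<in>{0<..<1}. (\<lambda>x. 1 - survival F x powr \<beta>) \<in> class_V"
    using distort_class_V[OF distortion_powr concave_powr_unit]
    by (simp add: powr_survival_eq_distort)
  show "\<forall>F\<in>class_H. \<forall>\<beta>\<in>{0<..<1}. (\<lambda>x. 1 - survival F x powr \<beta>) \<in> class_H"
    using distort_class_H[OF distortion_powr concave_powr_unit]
    by (simp add: powr_survival_eq_distort)
  show "\<forall>F\<in>class_Hstar. \<forall>\<beta>\<in>{0<..<1}. (\<lambda>x. 1 - survival F x powr \<beta>) \<in> class_Hstar"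
    using distort_class_Hstar[OF distortion_powr concave_powr_unit]
    by (simp add: powr_survival_eq_distort)
  show "\<forall>F\<in>class_G. \<forall>\<beta>\<in>{0<..<1}. (\<lambda>x. 1 - survival F x powr \<beta>) \<in> class_G"
    using powr_survival_class_G by auto
next
  have dF: "distribution_function F" if "F \<in> class_V \<or> F \<in> class_Hstar" for F
    using that by (auto simp: class_V_iff class_Hstar_iff nonneg_nondeg_iff)
  show "\<forall>F\<in>class_H. \<forall>G. distribution_function G \<and> lr_le F G \<longrightarrow> G \<in> class_H"
    using lr_le_class_H by blast
  show "\<forall>F\<in>class_V. \<forall>G. distribution_function G \<and> hr_le F G \<longrightarrow> G \<in> class_V"
    using survival_cross_class_V hr_le_survival_cross dF by blast
  show "\<forall>F\<in>class_Hstar. \<forall>G. distribution_function G \<and> hr_le F G \<longrightarrow> G \<in> class_Hstar"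
    using survival_cross_class_Hstar hr_le_survival_cross dF by blast
next
  show "\<forall>(n::nat) (w::nat \<Rightarrow> real) (F::nat \<Rightarrow> real \<Rightarrow> real).
        (\<forall>i\<in>{1..n}. 0 \<le> w i) \<and> (\<Sum>i=1..n. w i) = 1 \<longrightarrow>
          ((\<forall>i\<in>{1..n}. F i \<in> class_V) \<longrightarrow> (\<lambda>x. \<Sum>i=1..n. w i * F i x) \<in> class_V) \<and>
          ((\<forall>i\<in>{1..n}. F i \<in> class_H) \<longrightarrow> (\<lambda>x. \<Sum>i=1..n. w i * F i x) \<in> class_H) \<and>
          ((\<forall>i\<in>{1..n}. F i \<in> class_Hstar) \<longrightarrow>
             (\<lambda>x. \<Sum>i=1..n. w i * F i x) \<in> class_Hstar) \<and>
          ((\<forall>i\<in>{1..n}. F i \<in> class_G) \<and> (\<forall>i\<in>{1..<n}. st_le (F i) (F (i + 1))) \<longrightarrow>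
             (\<lambda>x. \<Sum>i=1..n. w i * F i x) \<in> class_G)"
  proof (intro allI impI, elim conjE)
    fix n :: nat and w :: "nat \<Rightarrow> real" and F :: "nat \<Rightarrow> real \<Rightarrow> real"
    assume "\<forall>i\<in>{1..n}. 0 \<le> w i" and w1: "(\<Sum>i=1..n. w i) = 1"
    then have w0: "0 \<le> w i" if "i \<in> {1..n}" for i using that by blast
    have mix: "(\<lambda>x. \<Sum>i=1..n. w i * F i x) = mixture {1..n} w F"
      by (simp add: fun_eq_iff mixture_def)
    have chain: "st_le (F i) (F j)"
      if "\<forall>i\<in>{1..<n}. st_le (F i) (F (i + 1))" "1 \<le> i" "i \<le> j" "j \<le> n" for i j
      using that(3,4)
    proof (induction j rule: dec_induct)
      case (step j)
      then have "st_le (F j) (F (j + 1))" using that(1,2) by simp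
      then show ?case using step by (force simp: st_le_def intro: order_trans)
    qed (simp add: st_le_def)
    show "((\<forall>i\<in>{1..n}. F i \<in> class_V) \<longrightarrow> (\<lambda>x. \<Sum>i=1..n. w i * F i x) \<in> class_V) \<and>
          ((\<forall>i\<in>{1..n}. F i \<in> class_H) \<longrightarrow> (\<lambda>x. \<Sum>i=1..n. w i * F i x) \<in> class_H) \<and>
          ((\<forall>i\<in>{1..n}. F i \<in> class_Hstar) \<longrightarrow>
             (\<lambda>x. \<Sum>i=1..n. w i * F i x) \<in> class_Hstar) \<and>
          ((\<forall>i\<in>{1..n}. F i \<in> class_G) \<and> (\<forall>i\<in>{1..<n}. st_le (F i) (F (i + 1))) \<longrightarrow>
             (\<lambda>x. \<Sum>i=1..n. w i * F i x) \<in> class_G)"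
      unfolding mix
    proof (intro conjI impI)
      show "mixture {1..n} w F \<in> class_V" if "\<forall>i\<in>{1..n}. F i \<in> class_V"
        by (rule mixture_class_V[OF w0 w1]) (use that in blast)+
      show "mixture {1..n} w F \<in> class_H" if "\<forall>i\<in>{1..n}. F i \<in> class_H"
        by (rule mixture_class_H[OF w0 w1]) (use that in blast)+
      show "mixture {1..n} w F \<in> class_Hstar" if "\<forall>i\<in>{1..n}. F i \<in> class_Hstar"
        by (rule mixture_class_Hstar[OF w0 w1]) (use that in blast)+
      show "mixture {1..n} w F \<in> class_G"
        if "(\<forall>i\<in>{1..n}. F i \<in> class_G) \<and> (\<forall>i\<in>{1..<n}. st_le (F i) (F (i + 1)))"
        by (rule mixture_class_G[OF w0 w1]) (use that chain in auto)
    qed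
  qed
qed

end
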